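(* Let $A\in\mathbb{R}^{n\times n_s}$ with $n\ge n_s$, let $1\le r\le \operatorname{rank}(A)$, and let $W\in\mathbb{R}^{n\times r}$ have as its (orthonormal) columns left singular vectors of $A$ corresponding to its $r$ largest singular values. Let $\widehat W\in\mathbb{R}^{n\times r}$ be any matrix with orthonormal columns, let $s\ge r$, and let $\widehat S\in\mathbb{R}^{n\times s}$ be a selection operator with $\operatorname{rank}(\widehat S^\top\widehat W)=r$. Put $\widehat{\mathbb{D}}=\widehat W(\widehat S^\top\widehat W)^\dagger\widehat S^\top$ and assume $\operatorname{rank}(\widehat{\mathbb D})=r$, $\widehat{\mathbb{D}}\ne 0$ and $\widehat{\mathbb{D}}\neq I_n$. Let $P_W=WW^\top$ and let $\theta_{\max}$ be the largest canonical angle between the column spaces of $W$ and $\widehat W$. Then for every $f\in\mathbb{R}^n$, $$\|f-\widehat{\mathbb{D}}f\|_2\le \|\widehat{\mathbb{D}}\|_2\left(\|(I_n-P_W)f\|_2+\sin\theta_{\max}\,\|P_Wf\|_2\right).$$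
   Context: A selection operator is a matrix each of whose columns is a nonzero scalar multiple of a column of the $n\times n$ identity matrix $I_n$. $\|\cdot\|_2$ is the Euclidean norm of vectors and the spectral norm of matrices; $M^\dagger$ is the Moore-Penrose pseudoinverse. For $W,\widehat W\in\mathbb{R}^{n\times r}$ with orthonormal columns, the canonical angles between their column spaces are $\theta_i=\arccos\sigma_i(W^\top\widehat W)\in[0,\pi/2]$, $i=1,\dots,r$, where $\sigma_1\ge\dots\ge\sigma_r$ are the singular values of $W^\top \widehat W$; $\theta_{\max}=\theta_r$, and $\sin\theta_{\max}=\|WW^\top-\widehat W\widehat W^\top\|_2$. *)

theory Defs
  imports "HOL-Analysis.Analysis" "HOL-Computational_Algebra.Polynomial"
begin

text \<open>A matrix with \<open>m\<close> rows and \<open>n\<close> columns has type \<open>real^'n^'m\<close>. The library norm on that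
  type is the Frobenius norm, so the spectral norm is introduced separately.\<close>

definition spectral_norm :: "real^'n^'m \<Rightarrow> real" where
  "spectral_norm M = onorm (\<lambda>x. M *v x)"

definition orthonormal_columns :: "real^'n^'m \<Rightarrow> bool" where
  "orthonormal_columns M \<longleftrightarrow> transpose M ** M = mat 1"

definition selection_operator :: "real^'s^'n \<Rightarrow> bool" where
  "selection_operator S \<longleftrightarrow>
     (\<forall>j. \<exists>c i. c \<noteq> 0 \<and> column j S = c *\<^sub>R column i (mat 1 :: real^'n^'n))"

text \<open>The four Penrose conditions have exactly one solution for every real matrix.\<close>

definition is_pseudoinverse :: "real^'n^'m \<Rightarrow> real^'m^'n \<Rightarrow> bool" where
  "is_pseudoinverse M X \<longleftrightarrow>
     M ** X ** M = M \<and> X ** M ** X = X \<and>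
     transpose (M ** X) = M ** X \<and> transpose (X ** M) = X ** M"

definition pseudoinverse :: "real^'n^'m \<Rightarrow> real^'m^'n" where
  "pseudoinverse M = (THE X. is_pseudoinverse M X)"

definition charpoly :: "real^'n^'n \<Rightarrow> real poly" where
  "charpoly B = det (\<chi> i j. (if i = j then [:0, 1:] else 0) - [:B $ i $ j:])"

text \<open>Singular values are the square roots of the eigenvalues of \<open>M\<^sup>T M\<close>, with multiplicity.
  For an \<open>m \<times> n\<close> matrix these are \<open>n\<close> values; if \<open>n > m\<close>, the last \<open>n - m\<close> of them are
  superfluous zeros.
  They are numbered from 1 in non-increasing order, so \<open>singular_value M i\<close> is meaningful
  for \<open>1 \<le> i \<le> min m n\<close>.\<close>

definition singular_values :: "real^'n^'m \<Rightarrow> real multiset" where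
  "singular_values M = image_mset sqrt (proots (charpoly (transpose M ** M)))"

definition singular_value :: "real^'n^'m \<Rightarrow> nat \<Rightarrow> real" where
  "singular_value M i = rev (sorted_list_of_multiset (singular_values M)) ! (i - 1)"

definition left_singular_vector :: "real^'n^'m \<Rightarrow> real \<Rightarrow> real^'m \<Rightarrow> bool" where
  "left_singular_vector M \<sigma> u \<longleftrightarrow>
     norm u = 1 \<and> (\<exists>v. norm v = 1 \<and> M *v v = \<sigma> *\<^sub>R u \<and> transpose M *v u = \<sigma> *\<^sub>R v)"

text \<open>The columns are indexed by the unordered type \<open>'r\<close>; the bijection \<open>e\<close> enumerates them so
  that the \<open>i\<close>-th one belongs to the \<open>i\<close>-th largest singular value (with multiplicity).\<close>

definition leading_left_singular_vectors :: "real^'n^'m \<Rightarrow> real^'r^'m \<Rightarrow> bool" where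
  "leading_left_singular_vectors M W \<longleftrightarrow>
     orthonormal_columns W \<and>
     (\<exists>e. bij_betw e {1..CARD('r)} (UNIV :: 'r set) \<and>
          (\<forall>i\<in>{1..CARD('r)}. left_singular_vector M (singular_value M i) (column (e i) W)))"

text \<open>Canonical angles between the column spaces of \<open>W\<close> and \<open>W'\<close>, both with orthonormal columns.
  The angles are non-decreasing in \<open>i\<close>, so the largest one has index \<open>CARD('r)\<close>.\<close>

definition canonical_angle :: "real^'r^'n \<Rightarrow> real^'r^'n \<Rightarrow> nat \<Rightarrow> real" where
  "canonical_angle W W' i = arccos (singular_value (transpose W ** W') i)"

definition max_canonical_angle :: "real^'r^'n \<Rightarrow> real^'r^'n \<Rightarrow> real" where
  "max_canonical_angle W W' = canonical_angle W W' CARD('r)"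

end

(* Since (Shat^T What)^+ is a left inverse, Dhat is a projection that fixes the columns of What.
   Hence f - Dhat f = (I - Dhat)(I - Phat) f with Phat = What What^T, and I - Dhat is bounded by the
   norm of Dhat, as for every nonzero projection. Split f into (I - P_W) f, on which I - Phat is a
   contraction, and P_W f = W x, for which |(I - Phat) W x|^2 = |x|^2 - |N^T x|^2 with N = W^T What;
   the smallest singular value cos(theta_max) of N bounds |N^T x| from below.
   Singular values are given through the roots of a characteristic polynomial, so the r-th one is the
   smallest only because the characteristic polynomial of a symmetric matrix has all its roots real;
   the minimum of |N x| on the unit sphere is then shown to be such a value. *)

theory Submission
  imports Defs "HOL-Computational_Algebra.Fundamental_Theorem_Algebra"
begin

section \<open>Adjoint identities for matrix-vector products\<close>

lemma inner_transpose_matrix_vector: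
  fixes M :: "real^'n^'m"
  shows "(transpose M *v x) \<bullet> y = x \<bullet> (M *v y)"
  by (simp add: transpose_matrix_vector dot_lmul_matrix)

lemma norm_matrix_vector_sq:
  fixes M :: "real^'n^'m"
  shows "(norm (M *v x))\<^sup>2 = x \<bullet> ((transpose M ** M) *v x)"
  using inner_transpose_matrix_vector[of M "M *v x" x]
  by (simp add: power2_norm_eq_inner matrix_vector_mul_assoc inner_commute)

lemma mat_vector_mult: "mat c *v v = c *s (v :: 'a::semiring_1^'n)"
  by (simp add: vec_eq_iff matrix_vector_mult_def mat_def if_distrib[of "\<lambda>x. x * _"] cong: if_cong)

subsection \<open>Real-rootedness of characteristic polynomials of symmetric matrices\<close>

text \<open>Evaluation at a point is a ring homomorphism, so it passes through the Leibniz
  expansion; the permutation signs enter as integer constants.\<close>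

lemma poly_det:
  fixes P :: "'a::comm_ring_1 poly^'n^'n"
  shows "poly (det P) x = det (\<chi> i j. poly (P $ i $ j) x)"
proof -
  have sgn: "poly (of_int k) x = of_int k" for k
    by (induction k) simp_all
  show ?thesis
    by (simp add: det_def poly_sum poly_prod sgn)
qed

lemma map_poly_of_real_add:
  "map_poly (of_real :: real \<Rightarrow> complex) (p + q) = map_poly of_real p + map_poly of_real q"
  by (intro poly_eqI) (simp add: coeff_map_poly)

lemma map_poly_of_real_mult:
  "map_poly (of_real :: real \<Rightarrow> complex) (p * q) = map_poly of_real p * map_poly of_real q"
  by (intro poly_eqI) (simp add: coeff_map_poly coeff_mult)

lemma map_poly_of_real_det:
  fixes P :: "real poly^'n^'n"
  shows "map_poly of_real (det P) = det (\<chi> i j. map_poly (of_real :: real \<Rightarrow> complex) (P $ i $ j))"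
proof -
  let ?h = "map_poly (of_real :: real \<Rightarrow> complex)"
  have hsum: "?h (sum g S) = (\<Sum>i\<in>S. ?h (g i))" for g :: "('n \<Rightarrow> 'n) \<Rightarrow> real poly" and S
    by (induction S rule: infinite_finite_induct) (simp_all add: map_poly_of_real_add)
  have hprod: "?h (prod g S) = (\<Prod>i\<in>S. ?h (g i))" for g :: "'n \<Rightarrow> real poly" and S
    by (induction S rule: infinite_finite_induct) (simp_all add: map_poly_of_real_mult)
  have hint: "?h (of_int k) = of_int k" for k
    by (simp add: of_int_poly map_poly_pCons)
  show ?thesis
    by (simp add: det_def hsum hprod hint map_poly_of_real_mult)
qed

lemma poly_charpoly: "poly (charpoly B) x = det (mat x - B)"
  unfolding charpoly_def poly_det
  by (intro arg_cong[where f = det]) (simp add: vec_eq_iff mat_def)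

lemma complex_poly_charpoly:
  "poly (map_poly of_real (charpoly B)) (z::complex) = det (mat z - (\<chi> i j. of_real (B $ i $ j)))"
  unfolding charpoly_def poly_det map_poly_of_real_det
  by (intro arg_cong[where f = det])
     (simp add: vec_eq_iff mat_def map_poly_pCons)

text \<open>The induction step for the coefficient uses the degree bound, so both are proved
  together. Factors may be constant, hence only an upper bound on the degree.\<close>

lemma
  fixes p :: "'i \<Rightarrow> 'a::comm_ring_1 poly"
  assumes "finite S" "\<And>i. i \<in> S \<Longrightarrow> degree (p i) \<le> 1"
  shows degree_prod_linear_le: "degree (\<Prod>i\<in>S. p i) \<le> card S"
    and coeff_prod_linear: "coeff (\<Prod>i\<in>S. p i) (card S) = (\<Prod>i\<in>S. coeff (p i) 1)"
proof -
  have "degree (\<Prod>i\<in>S. p i) \<le> card S \<and> coeff (\<Prod>i\<in>S. p i) (card S) = (\<Prod>i\<in>S. coeff (p i) 1)"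
    using assms
  proof (induction S rule: finite_induct)
    case (insert x F)
    have dx: "degree (p x) \<le> 1" and dF: "degree (\<Prod>i\<in>F. p i) \<le> card F"
      and cF: "coeff (\<Prod>i\<in>F. p i) (card F) = (\<Prod>i\<in>F. coeff (p i) 1)"
      using insert by auto
    have "degree (p x * (\<Prod>i\<in>F. p i)) \<le> 1 + card F"
      using degree_mult_le[of "p x" "\<Prod>i\<in>F. p i"] dx dF by linarith
    moreover have "coeff (p x * (\<Prod>i\<in>F. p i)) (1 + card F) = coeff (p x) 1 * coeff (\<Prod>i\<in>F. p i) (card F)"
    proof -
      have ab: "p x = [:coeff (p x) 0, coeff (p x) 1:]"
        using dx by (intro poly_eqI) (auto simp: coeff_pCons coeff_eq_0 split: nat.split)
      \<comment> \<open>This is the coefficient that the constant term of \<open>p x\<close> would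
        multiply.\<close>
      have "coeff (\<Prod>i\<in>F. p i) (Suc (card F)) = 0"
        using dF by (simp add: coeff_eq_0)
      then show ?thesis by (subst ab) simp
    qed
    ultimately show ?case using insert cF by simp
  qed simp
  then show "degree (\<Prod>i\<in>S. p i) \<le> card S"
    and "coeff (\<Prod>i\<in>S. p i) (card S) = (\<Prod>i\<in>S. coeff (p i) 1)" by auto
qed

text \<open>Taking the coefficient of degree n in the Leibniz expansion replaces each entry by its
  linear coefficient. These form the identity matrix, so the leading coefficient is 1.\<close>

lemma
  fixes B :: "real^'n^'n"
  shows degree_charpoly: "degree (charpoly B) = CARD('n)"
    and charpoly_nonzero: "charpoly B \<noteq> 0"
proof -
  define P :: "real poly^'n^'n" where "P = (\<chi> i j. (if i = j then [:0, 1:] else 0) - [:B $ i $ j:])"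
  have det: "charpoly B = det P"
    by (simp add: charpoly_def P_def)
  have deg: "degree (P $ i $ j) \<le> 1" for i j
    by (simp add: P_def)
  have c1: "coeff (P $ i $ j) 1 = (mat 1 :: real^'n^'n) $ i $ j" for i j
    by (simp add: P_def mat_def)
  have sgn: "of_int k * p = smult (of_int k) p" for k and p :: "real poly"
    by (simp add: of_int_poly)
  have "degree (det P) \<le> CARD('n)"
    unfolding det_def sgn
    by (intro degree_sum_le order.trans[OF degree_smult_le] degree_prod_linear_le finite_permutations deg)
       simp_all
  moreover have "coeff (det P) CARD('n) = det (mat 1 :: real^'n^'n)"
    unfolding det_def sgn
    by (simp add: coeff_sum coeff_prod_linear deg c1 One_nat_def[symmetric] del: One_nat_def)
  ultimately show "degree (charpoly B) = CARD('n)" and "charpoly B \<noteq> 0"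
    unfolding det using le_degree[of "det P" "CARD('n)"] by (auto simp: det_I)
qed

lemma det_zero_imp_kernel:
  fixes M :: "'a::field^'n^'n"
  assumes "det M = 0"
  obtains v where "v \<noteq> 0" "M *v v = 0"
  using assms invertible_det_nz[of M] matrix_left_invertible_ker[of M] invertible_left_inverse[of M]
  by auto

text \<open>Write a complex eigenvector as a + ib with a, b real. Symmetry equates (B a) . b with a
  . (B b), and the difference of the two is Im z times |a|^2 + |b|^2.\<close>

lemma symmetric_complex_eigenvalue_real:
  fixes B :: "real^'n^'n"
  assumes sym: "transpose B = B"
    and root: "poly (map_poly of_real (charpoly B)) (z::complex) = 0"
  shows "Im z = 0"
proof -
  obtain v where v: "v \<noteq> 0" and ker: "(mat z - (\<chi> i j. of_real (B $ i $ j))) *v v = 0"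
    using root det_zero_imp_kernel unfolding complex_poly_charpoly by metis
  define a where "a = (\<chi> i. Re (v $ i))"
  define b where "b = (\<chi> i. Im (v $ i))"
  have eig: "z * v $ i = (\<Sum>j\<in>UNIV. of_real (B $ i $ j) * v $ j)" for i
  proof -
    have "((mat z - (\<chi> i j. of_real (B $ i $ j))) *v v) $ i = 0"
      by (simp add: ker)
    then show ?thesis
      unfolding matrix_vector_mult_diff_rdistrib mat_vector_mult
      by (simp add: matrix_vector_mult_def)
  qed
  have Ba: "B *v a = Re z *\<^sub>R a - Im z *\<^sub>R b"
    using arg_cong[OF eig, of Re] by (simp add: vec_eq_iff matrix_vector_mult_def a_def b_def)
  have Bb: "B *v b = Re z *\<^sub>R b + Im z *\<^sub>R a"
    using arg_cong[OF eig, of Im] by (simp add: vec_eq_iff matrix_vector_mult_def a_def b_def)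
  have "(B *v a) \<bullet> b = a \<bullet> (B *v b)"
    using inner_transpose_matrix_vector[of B a b] sym by simp
  then have "Im z * (a \<bullet> a + b \<bullet> b) = 0"
    unfolding Ba Bb by (simp add: inner_diff_left inner_add_right algebra_simps)
  moreover have "a \<noteq> 0 \<or> b \<noteq> 0"
    using v by (auto simp: a_def b_def vec_eq_iff complex_eq_iff)
  then have "a \<bullet> a + b \<bullet> b \<noteq> 0"
    by (smt (verit) inner_ge_zero inner_eq_zero_iff)
  ultimately show ?thesis by simp
qed

lemma poly_map_poly_of_real: "poly (map_poly of_real p) (of_real x) = (of_real (poly p x) :: complex)"
  by (induction p) (simp_all add: map_poly_pCons)

text \<open>Each step splits off a linear factor: the fundamental theorem of algebra supplies a
  complex root, which is real by assumption, and the quotient inherits the assumption.\<close>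

lemma size_proots_real_rooted:
  fixes p :: "real poly"
  assumes "p \<noteq> 0" and "\<And>z::complex. poly (map_poly of_real p) z = 0 \<Longrightarrow> Im z = 0"
  shows "size (proots p) = degree p"
  using assms
proof (induction "degree p" arbitrary: p)
  case 0
  then show ?case by (metis size_proots_le le_zero_eq)
next
  case (Suc d)
  have "degree (map_poly complex_of_real p) = Suc d"
    using Suc.hyps(2) by (simp add: degree_map_poly)
  then obtain z where z: "poly (map_poly complex_of_real p) z = 0"
    using fundamental_theorem_of_algebra[of "map_poly complex_of_real p"]
    by (auto simp: constant_degree)
  then obtain x where zx: "z = of_real x"
    using Suc.prems(2) by (metis complex_is_Real_iff Reals_cases)
  then have "poly p x = 0"
    using z by (simp add: poly_map_poly_of_real)
  then obtain q where q: "p = [:- x, 1:] * q"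
    unfolding poly_eq_0_iff_dvd by (auto elim: dvdE)
  have q0: "q \<noteq> 0" using q Suc.prems(1) by auto
  have dq: "degree p = Suc (degree q)"
    using q0 unfolding q by (subst degree_mult_eq) auto
  have "Im w = 0" if "poly (map_poly complex_of_real q) w = 0" for w
    using that Suc.prems(2)[of w] unfolding q map_poly_of_real_mult by simp
  then have "size (proots q) = degree q"
    using Suc.hyps q0 dq by simp
  moreover have "proots p = {#x#} + proots q"
    unfolding q using q0 by (subst proots_mult) auto
  ultimately show ?case using dq by simp
qed

text \<open>This count guarantees that the index in \<open>singular_value N CARD('n)\<close> lies
  inside the list and hits its end.\<close>

lemma size_singular_values: "size (singular_values (N :: real^'n^'m)) = CARD('n)"
proof -
  have "transpose (transpose N ** N) = transpose N ** N"
    by (simp add: matrix_transpose_mul)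
  then have "size (proots (charpoly (transpose N ** N))) = CARD('n)"
    using size_proots_real_rooted[OF charpoly_nonzero symmetric_complex_eigenvalue_real]
    by (simp add: degree_charpoly)
  then show ?thesis by (simp add: singular_values_def)
qed

subsection \<open>The smallest singular value\<close>

lemma
  fixes N :: "real^'n^'m"
  shows singular_value_last_mem: "singular_value N CARD('n) \<in># singular_values N"
    and singular_value_last_le: "\<And>s. s \<in># singular_values N \<Longrightarrow> singular_value N CARD('n) \<le> s"
proof -
  define xs where "xs = sorted_list_of_multiset (singular_values N)"
  have len: "length xs = CARD('n)"
    by (metis size_mset size_singular_values mset_sorted_list_of_multiset xs_def)
  have set: "set xs = set_mset (singular_values N)" and sorted: "sorted xs"
    by (simp_all add: xs_def)
  have ne: "0 < length xs" using len by simp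
  \<comment> \<open>The list is ascending before \<open>rev\<close>, so the last value in the
    numbering is its head.\<close>
  have sv: "singular_value N CARD('n) = xs ! 0"
    using ne unfolding singular_value_def xs_def[symmetric] len[symmetric] by (subst rev_nth) auto
  show "singular_value N CARD('n) \<in># singular_values N"
    using ne sv set nth_mem by metis
  show "singular_value N CARD('n) \<le> s" if "s \<in># singular_values N" for s
    using that sorted unfolding sv set[symmetric] in_set_conv_nth by (auto simp: sorted_iff_nth_mono)
qed

lemma singular_values_iff:
  fixes N :: "real^'n^'m"
  shows "s \<in># singular_values N \<longleftrightarrow>
    (\<exists>l v. s = sqrt l \<and> v \<noteq> 0 \<and> (transpose N ** N) *v v = l *\<^sub>R v)"
proof -
  have "poly (charpoly B) l = 0 \<longleftrightarrow> (\<exists>v. v \<noteq> 0 \<and> B *v v = l *\<^sub>R v)" for B :: "real^'n^'n" and l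
  proof -
    have "(mat l - B) *v v = l *\<^sub>R v - B *v v" for v
      by (simp add: matrix_vector_mult_diff_rdistrib mat_vector_mult scalar_mult_eq_scaleR)
    then show ?thesis
      unfolding poly_charpoly
      using invertible_det_nz[of "mat l - B"] matrix_left_invertible_ker[of "mat l - B"]
        invertible_left_inverse[of "mat l - B"]
      by auto
  qed
  then show ?thesis
    by (auto simp: singular_values_def charpoly_nonzero)
qed

text \<open>A zero of a nonnegative form is a minimum; if \<open>C *v v\<close> were nonzero, a
  small step from \<open>v\<close> against it would make the form negative.\<close>

lemma psd_form_zero_imp_kernel:
  fixes C :: "real^'n^'n"
  assumes sym: "transpose C = C" and psd: "\<And>x. 0 \<le> x \<bullet> (C *v x)" and v: "v \<bullet> (C *v v) = 0"
  shows "C *v v = 0"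
proof (rule ccontr)
  assume ne: "C *v v \<noteq> 0"
  define w where "w = C *v v"
  define q where "q = w \<bullet> w"
  define c where "c = w \<bullet> (C *v w)"
  have q: "0 < q" using ne by (simp add: w_def q_def)
  have c: "0 \<le> c" by (simp add: c_def psd)
  have vw: "v \<bullet> (C *v w) = q"
    using inner_transpose_matrix_vector[of C v w] by (simp add: sym w_def q_def)
  \<comment> \<open>The form at \<open>v - t *\<^sub>R w\<close> is
    \<open>t * (t * c - 2 * q)\<close>, so a positive \<open>t\<close> with
    \<open>t * c < 2 * q\<close> is wanted; the \<open>+ 1\<close> covers
    \<open>c = 0\<close>.\<close>
  define t where "t = q / (c + 1)"
  have t: "0 < t" "t * c < 2 * q"
    using q c by (auto simp: t_def field_simps add_strict_increasing2)
  have "0 \<le> (v - t *\<^sub>R w) \<bullet> (C *v (v - t *\<^sub>R w))"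
    by (rule psd)
  also have "\<dots> = t * (t * c - 2 * q)"
    using v vw
    by (simp add: matrix_vector_mult_diff_distrib matrix_vector_mult_scaleR inner_diff_left
        inner_diff_right c_def q_def w_def[symmetric] algebra_simps)
  finally show False
    using t by (simp add: zero_le_mult_iff)
qed

text \<open>Let m be the minimum of |N y| on the unit sphere. The form of N^T N - m^2 I is
  nonnegative and vanishes at a minimizer, which is therefore an eigenvector for m^2. So m is a
  singular value, and the last one is at most m.\<close>

lemma singular_value_last_lower_bound:
  fixes N :: "real^'n^'m"
  shows "singular_value N CARD('n) * norm x \<le> norm (N *v x)"
proof -
  have "continuous_on (sphere 0 1) (\<lambda>x. norm (N *v x))"
    by (intro continuous_intros matrix_vector_mult_linear_continuous_on)
  moreover have "sphere (0::real^'n) 1 \<noteq> {}" by simp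
  ultimately obtain u where u: "norm u = 1" and min: "\<And>y. norm y = 1 \<Longrightarrow> norm (N *v u) \<le> norm (N *v y)"
    using continuous_attains_inf[OF compact_sphere] by (metis mem_sphere_0)
  define m where "m = norm (N *v u)"
  have bound: "m * norm y \<le> norm (N *v y)" for y
  proof (cases "y = 0")
    case False
    have "m \<le> norm (N *v ((1 / norm y) *\<^sub>R y))"
      unfolding m_def by (rule min) (simp add: False)
    then show ?thesis
      using False by (simp add: matrix_vector_mult_scaleR field_simps)
  qed simp
  define C where "C = transpose N ** N - mat (m\<^sup>2)"
  have Cv: "C *v y = (transpose N ** N) *v y - m\<^sup>2 *\<^sub>R y" for y
    by (simp add: C_def matrix_vector_mult_diff_rdistrib mat_vector_mult scalar_mult_eq_scaleR)
  have form: "y \<bullet> (C *v y) = (norm (N *v y))\<^sup>2 - (m * norm y)\<^sup>2" for y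
    unfolding Cv inner_diff_right norm_matrix_vector_sq[symmetric]
    by (simp add: power_mult_distrib power2_norm_eq_inner)
  have "transpose C = C"
  proof -
    have "transpose (transpose N ** N) = transpose N ** N"
      by (simp add: matrix_transpose_mul)
    then show ?thesis
      by (simp add: C_def vec_eq_iff transpose_def mat_def)
  qed
  moreover have "0 \<le> y \<bullet> (C *v y)" for y
    unfolding form using bound[of y] by (simp add: m_def power_mono)
  moreover have "u \<bullet> (C *v u) = 0"
    unfolding form by (simp add: u m_def)
  ultimately have "C *v u = 0"
    by (rule psd_form_zero_imp_kernel)
  then have "sqrt (m\<^sup>2) \<in># singular_values N"
    unfolding singular_values_iff Cv using u by (intro exI[of _ "m\<^sup>2"] exI[of _ u]) auto
  then have "singular_value N CARD('n) \<le> m"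
    using singular_value_last_le by (fastforce simp: m_def)
  then show ?thesis
    using bound[of x] by (meson mult_right_mono norm_ge_zero order_trans)
qed

lemma singular_value_last_attained:
  fixes N :: "real^'n^'m"
  obtains v where "norm v = 1" "norm (N *v v) = singular_value N CARD('n)"
proof -
  obtain l v where l: "singular_value N CARD('n) = sqrt l" and v: "v \<noteq> 0"
    and eig: "(transpose N ** N) *v v = l *\<^sub>R v"
    using singular_value_last_mem[of N] unfolding singular_values_iff by blast
  have "(norm (N *v v))\<^sup>2 = l * (norm v)\<^sup>2"
    unfolding norm_matrix_vector_sq eig by (simp add: power2_norm_eq_inner)
  \<comment> \<open>\<open>real_sqrt_mult\<close> holds on all reals, so the sign of
    \<open>l\<close> need not be settled first.\<close>
  then have "norm (N *v v) = sqrt l * norm v"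
    by (metis norm_ge_zero real_sqrt_abs real_sqrt_mult abs_norm_cancel)
  then show thesis
    using v l by (intro that[of "(1 / norm v) *\<^sub>R v"]) (simp_all add: matrix_vector_mult_scaleR)
qed

lemma singular_value_last_nonneg: "0 \<le> singular_value (N :: real^'n^'m) CARD('n)"
  using singular_value_last_attained[of N] by (metis norm_ge_zero)

text \<open>If the value s is positive, the square matrix N is invertible. With x = N z,
  Cauchy-Schwarz gives |x|^2 = (N^T x) . z <= |N^T x| |z|, and s |z| <= |x| finishes. This avoids
  comparing the spectra of N^T N and N N^T.\<close>

lemma singular_value_last_lower_bound_transpose:
  fixes N :: "real^'n^'n"
  shows "singular_value N CARD('n) * norm x \<le> norm (transpose N *v x)"
proof (cases "singular_value N CARD('n) = 0 \<or> x = 0")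
  case False
  define s where "s = singular_value N CARD('n)"
  have s: "0 < s" using False singular_value_last_nonneg[of N] by (simp add: s_def)
  have lb: "s * norm y \<le> norm (N *v y)" for y
    unfolding s_def by (rule singular_value_last_lower_bound)
  have "y = 0" if "N *v y = 0" for y
    using lb[of y] that s by (simp add: mult_le_0_iff)
  then have "invertible N"
    unfolding invertible_left_inverse matrix_left_invertible_ker by blast
  then obtain z where z: "x = N *v z"
    by (metis invertible_def matrix_vector_mul_assoc matrix_vector_mul_lid)
  have "s * (norm x)\<^sup>2 = s * ((transpose N *v x) \<bullet> z)"
    unfolding inner_transpose_matrix_vector z[symmetric] by (simp add: power2_norm_eq_inner)
  also have "\<dots> \<le> s * (norm (transpose N *v x) * norm z)"
    using s norm_cauchy_schwarz by (simp add: mult_left_mono)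
  also have "\<dots> = norm (transpose N *v x) * (s * norm z)"
    by simp
  also have "\<dots> \<le> norm (transpose N *v x) * norm x"
    using lb[of z] z by (simp add: mult_left_mono)
  finally show ?thesis
    using False by (simp add: s_def power2_eq_square)
qed auto

subsection \<open>Orthonormal columns and the largest canonical angle\<close>

lemma orthonormal_columns_norm:
  assumes "orthonormal_columns W"
  shows "norm (W *v x) = norm x"
proof -
  have "(norm (W *v x))\<^sup>2 = (norm x)\<^sup>2"
    using assms unfolding norm_matrix_vector_sq orthonormal_columns_def by (simp add: power2_norm_eq_inner)
  then show ?thesis by simp
qed

text \<open>Pythagoras: the residual is orthogonal to \<open>?p\<close>, whose length is that of its
  coordinate vector.\<close>

lemma orthonormal_columns_residual_sq:
  assumes "orthonormal_columns W"
  shows "(norm (g - W *v (transpose W *v g)))\<^sup>2 = (norm g)\<^sup>2 - (norm (transpose W *v g))\<^sup>2"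
proof -
  let ?p = "W *v (transpose W *v g)"
  have "g \<bullet> ?p = (norm (transpose W *v g))\<^sup>2"
    by (simp add: inner_transpose_matrix_vector[symmetric] power2_norm_eq_inner)
  moreover have "?p \<bullet> ?p = (norm (transpose W *v g))\<^sup>2"
    using orthonormal_columns_norm[OF assms] by (simp add: power2_norm_eq_inner[symmetric])
  ultimately show ?thesis
    by (simp add: power2_norm_eq_inner inner_diff_left inner_diff_right inner_commute)
qed

lemma orthonormal_columns_residual_le:
  assumes "orthonormal_columns W"
  shows "norm (g - W *v (transpose W *v g)) \<le> norm g"
proof (rule power2_le_imp_le)
  show "(norm (g - W *v (transpose W *v g)))\<^sup>2 \<le> (norm g)\<^sup>2"
    unfolding orthonormal_columns_residual_sq[OF assms] by simp
qed simp

lemma norm_transpose_orthonormal_le: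
  assumes "orthonormal_columns W"
  shows "norm (transpose W *v g) \<le> norm g"
proof (rule power2_le_imp_le)
  show "(norm (transpose W *v g))\<^sup>2 \<le> (norm g)\<^sup>2"
    using orthonormal_columns_residual_sq[OF assms, of g]
      zero_le_power2[of "norm (g - W *v (transpose W *v g))"] by linarith
qed simp

lemma residual_le_sin_max_canonical_angle:
  fixes W W' :: "real^'r^'n"
  assumes W: "orthonormal_columns W" and W': "orthonormal_columns W'"
  shows "norm (W *v x - W' *v (transpose W' *v (W *v x))) \<le> sin (max_canonical_angle W W') * norm x"
proof -
  define N where "N = transpose W ** W'"
  define s where "s = singular_value N CARD('r)"
  have s0: "0 \<le> s" by (simp add: s_def singular_value_last_nonneg)
  \<comment> \<open>This vector serves to show s <= 1, so that s lies in the domain of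
    \<open>arccos\<close> and the sine is sqrt (1 - s^2).\<close>
  obtain v where v: "norm v = 1" "norm (N *v v) = s"
    unfolding s_def by (rule singular_value_last_attained)
  have "norm (N *v v) \<le> norm (W' *v v)"
    unfolding N_def matrix_vector_mul_assoc[symmetric] by (rule norm_transpose_orthonormal_le[OF W])
  then have s1: "s \<le> 1" using v orthonormal_columns_norm[OF W'] by simp
  have sin: "sin (max_canonical_angle W W') = sqrt (1 - s\<^sup>2)"
    using s0 s1 by (simp add: max_canonical_angle_def canonical_angle_def N_def[symmetric]
        s_def[symmetric] sin_arccos)
  \<comment> \<open>The transpose appears here although the angle is defined through
    \<open>N\<close>; hence the transposed lower bound.\<close>
  have "transpose W' *v (W *v x) = transpose N *v x"
    by (simp add: N_def matrix_transpose_mul matrix_vector_mul_assoc)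
  moreover have "(s * norm x)\<^sup>2 \<le> (norm (transpose N *v x))\<^sup>2"
    using singular_value_last_lower_bound_transpose[of N x] s0 by (simp add: s_def power_mono)
  ultimately have "(norm (W *v x - W' *v (transpose W' *v (W *v x))))\<^sup>2 \<le> (norm x)\<^sup>2 - (s * norm x)\<^sup>2"
    unfolding orthonormal_columns_residual_sq[OF W'] by (simp add: orthonormal_columns_norm[OF W])
  also have "\<dots> = (1 - s\<^sup>2) * (norm x)\<^sup>2"
    by (simp add: power_mult_distrib algebra_simps)
  finally have "norm (W *v x - W' *v (transpose W' *v (W *v x))) \<le> sqrt ((1 - s\<^sup>2) * (norm x)\<^sup>2)"
    by (rule real_le_rsqrt)
  then show ?thesis
    by (simp add: sin real_sqrt_mult)
qed

subsection \<open>Pseudoinverses and oblique projections\<close>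

text \<open>\<open>M ** X\<close> and \<open>M ** Y\<close> are symmetric and each absorbs the
  other, so transposing a product identifies them; likewise for \<open>X ** M\<close> and
  \<open>Y ** M\<close>. This makes the definite description in \<open>pseudoinverse\<close>
  usable.\<close>

lemma is_pseudoinverse_unique:
  assumes X: "is_pseudoinverse M X" and Y: "is_pseudoinverse M Y"
  shows "X = Y"
proof -
  have MX: "M ** X = M ** Y"
  proof -
    have "M ** X = transpose (M ** X)" using X by (simp add: is_pseudoinverse_def)
    also have "\<dots> = transpose ((M ** Y) ** (M ** X))"
      using Y by (simp add: is_pseudoinverse_def matrix_mul_assoc)
    also have "\<dots> = (M ** X) ** (M ** Y)"
      using X Y by (simp add: is_pseudoinverse_def matrix_transpose_mul[of "M ** Y"])
    also have "\<dots> = M ** Y" using X by (simp add: is_pseudoinverse_def matrix_mul_assoc)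
    finally show ?thesis .
  qed
  have XM: "X ** M = Y ** M"
  proof -
    have "X ** M = transpose (X ** M)" using X by (simp add: is_pseudoinverse_def)
    also have "\<dots> = transpose ((X ** M) ** (Y ** M))"
      using Y by (simp add: is_pseudoinverse_def matrix_mul_assoc[symmetric])
    also have "\<dots> = (Y ** M) ** (X ** M)"
      using X Y by (simp add: is_pseudoinverse_def matrix_transpose_mul[of "X ** M"])
    also have "\<dots> = Y ** M" using X by (simp add: is_pseudoinverse_def matrix_mul_assoc[symmetric])
    finally show ?thesis .
  qed
  show ?thesis
  proof -
    have "X = X ** (M ** X)" using X by (simp add: is_pseudoinverse_def matrix_mul_assoc)
    also have "\<dots> = (Y ** M) ** Y" by (simp add: MX matrix_mul_assoc XM)
    also have "\<dots> = Y" using Y by (simp add: is_pseudoinverse_def)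
    finally show ?thesis .
  qed
qed

text \<open>Full column rank makes M^T M invertible, and (M^T M)^{-1} M^T is then a left inverse
  satisfying the Penrose conditions; symmetry of the inverse gives the one on
  \<open>M ** X\<close>.\<close>

lemma pseudoinverse_left_inverse:
  fixes M :: "real^'n^'m"
  assumes "rank M = CARD('n)"
  shows "pseudoinverse M ** M = mat 1"
proof -
  have inj: "x = 0" if "M *v x = 0" for x
    using assms that full_rank_injective[of M] by (metis injD matrix_vector_mult_0_right)
  have "x = 0" if "(transpose M ** M) *v x = 0" for x
    using norm_matrix_vector_sq[of M x] that inj by simp
  then have "invertible (transpose M ** M)"
    unfolding invertible_left_inverse matrix_left_invertible_ker by blast
  then obtain G where G: "G ** (transpose M ** M) = mat 1" "(transpose M ** M) ** G = mat 1"
    unfolding invertible_def by blast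
  have symG: "transpose G = G"
  proof -
    have "transpose M ** M ** transpose G = mat 1"
      using arg_cong[OF G(1), of transpose] by (simp add: matrix_transpose_mul)
    then show ?thesis
      by (metis G(1) matrix_mul_assoc matrix_mul_lid matrix_mul_rid)
  qed
  define X where "X = G ** transpose M"
  have XM: "X ** M = mat 1"
    using G(1) by (simp add: X_def matrix_mul_assoc)
  have "transpose (M ** X) = M ** X"
    by (simp add: X_def matrix_transpose_mul symG matrix_mul_assoc)
  then have "is_pseudoinverse M X"
    by (simp add: is_pseudoinverse_def XM matrix_mul_assoc[symmetric])
  then have "pseudoinverse M = X"
    unfolding pseudoinverse_def using is_pseudoinverse_unique by blast
  then show ?thesis using XM by simp
qed

lemma norm_le_spectral_norm: "norm (M *v x) \<le> spectral_norm M * norm x"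
  unfolding spectral_norm_def by (rule onorm) (rule matrix_vector_mul_bounded_linear)

lemma spectral_norm_nonneg: "0 \<le> spectral_norm M"
  unfolding spectral_norm_def by (rule onorm_pos_le) (rule matrix_vector_mul_bounded_linear)

text \<open>Swapping the lengths of \<open>u = D g\<close> and
  \<open>v = g - D g\<close> keeps the norm of the sum and turns \<open>norm v\<close> into the norm of an image under \<open>D\<close>.\<close>

lemma projection_complement_norm_le:
  fixes D :: "real^'n^'n"
  assumes idem: "D ** D = D" and nz: "D \<noteq> 0"
  shows "norm (g - D *v g) \<le> spectral_norm D * norm g"
proof -
  define u where "u = D *v g"
  define v where "v = g - u"
  have Du: "D *v u = u" by (simp add: u_def matrix_vector_mul_assoc idem)
  have Dv: "D *v v = 0" by (simp add: v_def matrix_vector_mult_diff_distrib Du) (simp add: u_def)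
  consider "u = 0" | "v = 0" | "u \<noteq> 0" "v \<noteq> 0" by blast
  then have "norm v \<le> spectral_norm D * norm g"
  proof cases
    case 1
    \<comment> \<open>Here v = g, so the claim needs spectral norm at least 1; the nonzero vector
      \<open>D *v h\<close> is fixed by \<open>D\<close> and shows this.\<close>
    obtain h where h: "D *v h \<noteq> 0"
      using nz by (metis matrix_eq matrix_vector_mult_0)
    have "norm (D *v h) \<le> spectral_norm D * norm (D *v h)"
      using norm_le_spectral_norm[of D "D *v h"] by (simp add: matrix_vector_mul_assoc idem)
    then have "1 \<le> spectral_norm D" using h by simp
    then show ?thesis
      using 1 mult_right_mono[of 1 "spectral_norm D" "norm g"] by (simp add: v_def)
  next
    case 2
    then show ?thesis by (simp add: spectral_norm_nonneg)
  next
    case 3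
    define w where "w = (norm v / norm u) *\<^sub>R u + (norm u / norm v) *\<^sub>R v"
    have "D *v w = (norm v / norm u) *\<^sub>R u"
      by (simp add: w_def matrix_vector_right_distrib matrix_vector_mult_scaleR Du Dv)
    then have "norm (D *v w) = norm v" using 3 by simp
    \<comment> \<open>The two scaling factors are reciprocal: the cross term is unchanged and the
      squared lengths trade places.\<close>
    moreover have "w \<bullet> w = (u + v) \<bullet> (u + v)"
    proof -
      define a b where "a = norm u" and "b = norm v"
      have ab: "a \<noteq> 0" "b \<noteq> 0" using 3 by (simp_all add: a_def b_def)
      have uu: "u \<bullet> u = a\<^sup>2" and vv: "v \<bullet> v = b\<^sup>2"
        by (simp_all add: a_def b_def power2_norm_eq_inner)
      have "w \<bullet> w = (b / a)\<^sup>2 * (u \<bullet> u) + 2 * ((b / a) * (a / b)) * (u \<bullet> v) + (a / b)\<^sup>2 * (v \<bullet> v)"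
        by (simp add: w_def a_def[symmetric] b_def[symmetric] inner_add_left inner_add_right
            inner_commute[of v u] power2_eq_square algebra_simps)
      also have "\<dots> = a\<^sup>2 + 2 * (u \<bullet> v) + b\<^sup>2"
        using ab by (simp add: uu vv power_divide)
      also have "\<dots> = (u + v) \<bullet> (u + v)"
        by (simp add: uu[symmetric] vv[symmetric] inner_add_left inner_add_right inner_commute[of v u])
      finally show ?thesis .
    qed
    then have "norm w = norm g"
      by (simp add: norm_eq_sqrt_inner v_def)
    ultimately show ?thesis
      using norm_le_spectral_norm[of D w] by simp
  qed
  then show ?thesis by (simp add: v_def u_def)
qed

section \<open>The error bound for the oblique projection\<close>

theorem theorem4p1:
  fixes A :: "real^'ns^'n"
    and W What :: "real^'r^'n"
    and Shat :: "real^'s^'n"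
    and Dhat P\<^sub>W :: "real^'n^'n"
    and f :: "real^'n"
  assumes "CARD('ns) \<le> CARD('n)"
    and "1 \<le> CARD('r)" and "CARD('r) \<le> rank A"
    and "leading_left_singular_vectors A W"
    and "orthonormal_columns What"
    and "CARD('r) \<le> CARD('s)"
    and "selection_operator Shat"
    and "rank (transpose Shat ** What) = CARD('r)"
    and Dhat_def: "Dhat = What ** pseudoinverse (transpose Shat ** What) ** transpose Shat"
    and "rank Dhat = CARD('r)" and "Dhat \<noteq> 0" and "Dhat \<noteq> mat 1"
    and P_W_def: "P\<^sub>W = W ** transpose W"
  shows "norm (f - Dhat *v f)
    \<le> spectral_norm Dhat *
       (norm ((mat 1 - P\<^sub>W) *v f) + sin (max_canonical_angle W What) * norm (P\<^sub>W *v f))"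
proof -
  define M where "M = transpose Shat ** What"
  have W: "orthonormal_columns W"
    using assms(4) by (simp add: leading_left_singular_vectors_def)
  have inv: "pseudoinverse M ** M = mat 1"
    using assms(8) by (intro pseudoinverse_left_inverse) (simp add: M_def)
  have DW: "Dhat ** What = What"
  proof -
    have "Dhat ** What = What ** (pseudoinverse M ** M)"
      by (simp add: Dhat_def M_def matrix_mul_assoc)
    then show ?thesis by (simp add: inv)
  qed
  have idem: "Dhat ** Dhat = Dhat"
    by (metis DW Dhat_def matrix_mul_assoc)
  define R where "R g = g - What *v (transpose What *v g)" for g
  define p where "p = P\<^sub>W *v f"
  have p: "p = W *v (transpose W *v f)"
    by (simp add: p_def P_W_def matrix_vector_mul_assoc del: transpose_matrix_vector)
  have R_add: "R (g + h) = R g + R h" for g h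
    by (simp add: R_def matrix_vector_right_distrib)
  have "Dhat *v (What *v y) = What *v y" for y
    by (simp add: matrix_vector_mul_assoc DW)
  \<comment> \<open>The part of \<open>f\<close> removed by \<open>R\<close> lies in the range of
    \<open>What\<close>, where \<open>I - Dhat\<close> vanishes.\<close>
  then have "f - Dhat *v f = R f - Dhat *v R f"
    by (simp add: R_def matrix_vector_mult_diff_distrib)
  then have "norm (f - Dhat *v f) \<le> spectral_norm Dhat * norm (R f)"
    using projection_complement_norm_le[OF idem \<open>Dhat \<noteq> 0\<close>] by simp
  also have "norm (R f) \<le> norm (R (f - p)) + norm (R p)"
    using R_add[of "f - p" p] norm_triangle_ineq[of "R (f - p)" "R p"] by simp
  also have "norm (R (f - p)) \<le> norm ((mat 1 - P\<^sub>W) *v f)"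
    using orthonormal_columns_residual_le[OF assms(5), of "f - p"]
    by (simp add: R_def p_def matrix_vector_mult_diff_rdistrib)
  \<comment> \<open>The angle estimate is applied to the coordinates of \<open>p\<close>, which have
    the norm of \<open>p\<close> as \<open>W\<close> is isometric.\<close>
  also have "norm (R p) \<le> sin (max_canonical_angle W What) * norm p"
    using residual_le_sin_max_canonical_angle[OF W assms(5), of "transpose W *v f"]
    by (simp add: R_def p orthonormal_columns_norm[OF W])
  \<comment> \<open>The bounds on \<open>norm (R f)\<close> are inserted under the factor
    \<open>spectral_norm Dhat\<close>, which preserves them by being nonnegative.\<close>
  finally show ?thesis
    by (simp add: p_def spectral_norm_nonneg mult_left_mono)
qed

end
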